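(* Let $W$ be the smooth part of the fundamental solution of $u_t=\int_{\mathbb R^N}J(x-y)(u(y,t)-u(x,t))\,dy$. There exists a constant $C>0$ depending only on $J$ and $N$ such that $$W(x,t)\le C\,\frac{t}{|x|^{N+2}}\qquad\text{for all }x\in\mathbb R^N\setminus\{0\},\ t>0.$$
   Context: $J\in C_0^\infty(\mathbb R^N)$ is radially symmetric, $J\ge0$, $\int J=1$. The fundamental solution of $u_t=Lu$, $Lu(x,t)=\int J(x-y)(u(y,t)-u(x,t))\,dy$, can be written as $e^{-t}\delta+W(x,t)$, where $\delta$ is the Dirac measure at the origin and $W$ is a smooth function. Equivalently, $W$ is the solution (bounded on finite time intervals) of $W_t(x,t)=\int J(x-y)\big(W(y,t)-W(x,t)\big)\,dy+e^{-t}J(x)$ in $\mathbb R^N\times(0,\infty)$, $W(x,0)=0$. *)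

theory Defs
  imports "HOL-Analysis.Analysis"
begin

text \<open>The set S is meant to be open; continuity of all iterated directional derivatives
  on an open set is the usual notion of being n times continuously differentiable there.\<close>

primrec Ck_on :: "nat \<Rightarrow> ('a::euclidean_space \<Rightarrow> real) \<Rightarrow> 'a set \<Rightarrow> bool" where
  "Ck_on 0 f S \<longleftrightarrow> continuous_on S f"
| "Ck_on (Suc n) f S \<longleftrightarrow>
     (\<forall>x\<in>S. f differentiable (at x)) \<and>
     (\<forall>v. Ck_on n (\<lambda>x. frechet_derivative f (at x) v) S)"

definition smooth_on :: "('a::euclidean_space \<Rightarrow> real) \<Rightarrow> 'a set \<Rightarrow> bool" where
  "smooth_on f S \<longleftrightarrow> (\<forall>n. Ck_on n f S)"

definition compactly_supported :: "('a::euclidean_space \<Rightarrow> real) \<Rightarrow> bool" where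
  "compactly_supported f \<longleftrightarrow> compact (closure {x. f x \<noteq> 0})"

definition radially_symmetric :: "('a::euclidean_space \<Rightarrow> real) \<Rightarrow> bool" where
  "radially_symmetric f \<longleftrightarrow> (\<forall>x y. norm x = norm y \<longrightarrow> f x = f y)"

definition nonlocal_op :: "('a::euclidean_space \<Rightarrow> real) \<Rightarrow> ('a \<Rightarrow> real) \<Rightarrow> 'a \<Rightarrow> real" where
  "nonlocal_op J u x = (\<integral>y. J (x - y) * (u y - u x) \<partial>lborel)"

text \<open>W is the smooth part of the fundamental solution \<open>exp (-t) \<delta> + W\<close> of
  \<open>u\<^sub>t = nonlocal_op J u\<close>. Formally applying the operator to the Dirac measure
  \<open>\<delta>\<close> at the origin gives \<open>J - \<delta>\<close> (as \<open>J\<close> has integral 1), so the singular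
  parts cancel in the equation and the remainder is the forcing term \<open>exp (-t) J\<close> in the
  problem for W; the initial datum \<open>\<delta>\<close> is carried by the singular part, whence
  \<open>W = 0\<close> at time 0. Continuity is required up to time 0, so that the initial condition
  constrains the values at positive times. Values of W at negative times are irrelevant.\<close>

definition fundamental_smooth_part ::
    "('a::euclidean_space \<Rightarrow> real) \<Rightarrow> ('a \<Rightarrow> real \<Rightarrow> real) \<Rightarrow> bool" where
  "fundamental_smooth_part J W \<longleftrightarrow>
     smooth_on (\<lambda>(x, t). W x t) (UNIV \<times> {0<..}) \<and>
     continuous_on (UNIV \<times> {0..}) (\<lambda>(x, t). W x t) \<and>
     (\<forall>T>0. \<exists>M. \<forall>x. \<forall>t\<in>{0..T}. \<bar>W x t\<bar> \<le> M) \<and>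
     (\<forall>x. \<forall>t>0. ((\<lambda>s. W x s) has_real_derivative
        (nonlocal_op J (\<lambda>y. W y t) x + exp (- t) * J x)) (at t)) \<and>
     (\<forall>x. W x 0 = 0)"

end

theory Submission
  imports Defs
begin

text \<open>Write \<open>J\<^sup>*\<^sup>k\<close> for the convolution powers, so that
  \<open>exp t * W x t = \<Sum>k\<ge>1. t ^ k / k! * J\<^sup>*\<^sup>k x\<close>. It suffices that
  \<open>|x|\<^sup>N\<^sup>+\<^sup>2 J\<^sup>*\<^sup>k x \<le> C k\<close>: then the sum is at most \<open>C t exp t / |x|\<^sup>N\<^sup>+\<^sup>2\<close>.
  For \<open>|x|\<^sup>2 \<le> K k\<close> this follows from \<open>J\<^sup>*\<^sup>k \<le> C k\<^sup>-\<^sup>N\<^sup>/\<^sup>2\<close>, which comes from a Nash type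
  inequality for \<open>J\<^sup>*\<^sup>2\<^sup>k = J\<^sup>*\<^sup>k * J\<^sup>*\<^sup>k\<close>. For \<open>|x|\<^sup>2 > K k\<close> it is propagated by induction on \<open>k\<close>, because
  averaging \<open>|x|\<^sup>-\<^sup>N\<^sup>-\<^sup>2\<close> against \<open>J\<close> costs only a factor \<open>1 + c / |x|\<^sup>2 \<le> 1 + 1 / k\<close>.\<close>

section \<open>Convolution of even densities\<close>

lemma lborel_integral_translate:
  fixes f :: "'a::euclidean_space \<Rightarrow> real"
  assumes [measurable]: "f \<in> borel_measurable borel"
  shows "(\<integral>x. f (x - a) \<partial>lborel) = (\<integral>x. f x \<partial>lborel)"
    and "integrable lborel (\<lambda>x. f (x - a)) \<longleftrightarrow> integrable lborel f"
proof -
  have eq: "lborel = distr lborel borel (\<lambda>x::'a. x - a)"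
  proof -
    have "(\<lambda>x::'a. x - a) = (+) (- a)" by auto
    then show ?thesis using lborel_distr_plus[of "- a"] by simp
  qed
  show "(\<integral>x. f (x - a) \<partial>lborel) = (\<integral>x. f x \<partial>lborel)"
    by (subst (2) eq) (simp add: integral_distr)
  show "integrable lborel (\<lambda>x. f (x - a)) \<longleftrightarrow> integrable lborel f"
    by (subst (2) eq) (simp add: integrable_distr_eq)
qed

lemma lborel_integral_reflect:
  fixes f :: "'a::euclidean_space \<Rightarrow> real"
  assumes [measurable]: "f \<in> borel_measurable borel"
  shows "(\<integral>x. f (a - x) \<partial>lborel) = (\<integral>x. f x \<partial>lborel)"
    and "integrable lborel (\<lambda>x. f (a - x)) \<longleftrightarrow> integrable lborel f"
proof -
  have eq: "lborel = distr lborel borel (\<lambda>x::'a. a - x)"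
    using lborel_affine[of "- 1" a] by (simp add: density_1)
  show "(\<integral>x. f (a - x) \<partial>lborel) = (\<integral>x. f x \<partial>lborel)"
    by (subst (2) eq) (simp add: integral_distr)
  show "integrable lborel (\<lambda>x. f (a - x)) \<longleftrightarrow> integrable lborel f"
    by (subst (2) eq) (simp add: integrable_distr_eq)
qed

definition conv :: "('a::euclidean_space \<Rightarrow> real) \<Rightarrow> ('a \<Rightarrow> real) \<Rightarrow> 'a \<Rightarrow> real" where
  "conv f g x = (\<integral>y. f y * g (x - y) \<partial>lborel)"

text \<open>A class of kernels closed under \<open>conv\<close>. Boundedness makes every convolution
  integral converge pointwise, and evenness identifies convolutions with correlations.\<close>

definition even_density :: "('a::euclidean_space \<Rightarrow> real) \<Rightarrow> bool" where
  "even_density f \<longleftrightarrow> continuous_on UNIV f \<and> (\<forall>x. 0 \<le> f x) \<and> (\<forall>x. f (- x) = f x) \<and>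
     bounded (range f) \<and> integrable lborel f \<and> integral\<^sup>L lborel f = 1"

lemma even_densityD:
  assumes "even_density f"
  shows "continuous_on UNIV f" "f \<in> borel_measurable borel" "0 \<le> f x" "f (- x) = f x"
    "integrable lborel f" "integral\<^sup>L lborel f = 1" "bounded (range f)"
  using assms by (auto simp: even_density_def intro: borel_measurable_continuous_onI)

lemma even_density_bound:
  assumes "even_density f"
  obtains M where "\<And>x. f x \<le> M"
proof -
  obtain M where "\<And>x. norm (f x) \<le> M"
    using even_densityD(7)[OF assms] by (auto simp: bounded_iff)
  then show ?thesis
    using that by (metis abs_le_D1 real_norm_def)
qed

lemma integrable_mult_bounded:
  fixes f g :: "'a::euclidean_space \<Rightarrow> real"
  assumes f: "integrable lborel f" and g: "g \<in> borel_measurable borel" and b: "\<And>x. \<bar>g x\<bar> \<le> M"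
  shows "integrable lborel (\<lambda>x. f x * g x)"
proof (rule Bochner_Integration.integrable_bound[where f="\<lambda>x. M * f x"])
  show "integrable lborel (\<lambda>x. M * f x)" using f by simp
  show "(\<lambda>x. f x * g x) \<in> borel_measurable lborel" using f g by simp
  show "AE x in lborel. norm (f x * g x) \<le> norm (M * f x)"
  proof (intro AE_I2)
    fix x
    have "\<bar>g x\<bar> \<le> \<bar>M\<bar>" using b[of x] by linarith
    then have "\<bar>g x\<bar> * \<bar>f x\<bar> \<le> \<bar>M\<bar> * \<bar>f x\<bar>" by (rule mult_right_mono) simp
    then show "norm (f x * g x) \<le> norm (M * f x)" by (simp add: abs_mult mult.commute)
  qed
qed

lemma conv_integrable:
  assumes f: "even_density f" and g: "even_density g"
  shows "integrable lborel (\<lambda>y. f y * g (x - y))"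
proof -
  obtain M where M: "\<And>x. g x \<le> M" using even_density_bound[OF g] by blast
  have [measurable]: "g \<in> borel_measurable borel" using even_densityD[OF g] by simp
  show ?thesis
    by (rule integrable_mult_bounded[where M=M]) (use M even_densityD(5)[OF f] even_densityD(3)[OF g] in simp_all)
qed

lemma conv_le_bound:
  assumes f: "even_density f" and g: "even_density g" and M: "\<And>x. g x \<le> M"
  shows "conv f g x \<le> M"
proof -
  have "conv f g x \<le> (\<integral>y. f y * M \<partial>lborel)" unfolding conv_def
    using conv_integrable[OF f g] even_densityD(3,5)[OF f] M by (intro integral_mono mult_left_mono) simp_all
  then show ?thesis using even_densityD(6)[OF f] by simp
qed

text \<open>By translation invariance the inner integral in \<open>x\<close> is \<open>f y\<close>
  times the mass of \<open>g\<close>, so Tonelli applies. This yields both integrability and total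
  mass of \<open>conv f g\<close>.\<close>

lemma conv_pair_integrable:
  assumes f: "even_density f" and g: "even_density g"
  shows "integrable (lborel \<Otimes>\<^sub>M lborel) (\<lambda>(y, x). f y * g (x - y))"
proof (rule lborel_pair.Fubini_integrable)
  note [measurable] = even_densityD(2)[OF f] even_densityD(2)[OF g]
  show "(\<lambda>(y, x). f y * g (x - y)) \<in> borel_measurable (lborel \<Otimes>\<^sub>M lborel)"
    by measurable
  show "integrable lborel (\<lambda>y. \<integral>x. norm (case (y, x) of (y, x) \<Rightarrow> f y * g (x - y)) \<partial>lborel)"
    using even_densityD(3,5,6)[OF f] even_densityD(3,5,6)[OF g]
    by (simp add: abs_mult lborel_integral_translate)
  show "AE y in lborel. integrable lborel (\<lambda>x. case (y, x) of (y, x) \<Rightarrow> f y * g (x - y))"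
    using even_densityD(3,5,6)[OF f] even_densityD(3,5,6)[OF g] by (simp add: lborel_integral_translate)
qed

lemma conv_even_density:
  assumes f: "even_density f" and g: "even_density g"
  shows "even_density (conv f g)"
proof -
  note [measurable] = even_densityD(2)[OF f] even_densityD(2)[OF g]
  obtain M where M: "\<And>x. g x \<le> M" using even_density_bound[OF g] by blast
  have nonneg: "0 \<le> conv f g x" for x
    unfolding conv_def by (intro integral_nonneg_AE AE_I2 mult_nonneg_nonneg even_densityD f g)
  have cont: "continuous_on UNIV (conv f g)"
  proof (rule continuous_at_imp_continuous_on, intro ballI, unfold continuous_at_sequentially, intro allI impI)
    fix x and s :: "nat \<Rightarrow> 'a" assume s: "s \<longlonglongrightarrow> x"
    show "(conv f g \<circ> s) \<longlonglongrightarrow> conv f g x"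
      unfolding conv_def o_def
    proof (rule integral_dominated_convergence[where w="\<lambda>y. f y * M"])
      show "AE y in lborel. (\<lambda>n. f y * g (s n - y)) \<longlonglongrightarrow> f y * g (x - y)"
      proof (intro AE_I2 tendsto_mult tendsto_const)
        fix y
        have "isCont g (x - y)" using even_densityD(1)[OF g] by (simp add: continuous_on_eq_continuous_at)
        then show "(\<lambda>n. g (s n - y)) \<longlonglongrightarrow> g (x - y)"
          by (rule isCont_tendsto_compose) (intro tendsto_intros s)
      qed
      show "AE y in lborel. norm (f y * g (s n - y)) \<le> f y * M" for n
        using even_densityD(3)[OF f] even_densityD(3)[OF g] M by (simp add: abs_mult mult_left_mono)
    qed (use even_densityD(5)[OF f] in simp_all)
  qed
  have even: "conv f g (- x) = conv f g x" for x
  proof -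
    have "conv f g (- x) = (\<integral>y. f (- y) * g (- x - - y) \<partial>lborel)"
      unfolding conv_def
      using lborel_integral_reflect(1)[of "\<lambda>y. f y * g (- x - y)" 0] by simp
    also have "(\<lambda>y. f (- y) * g (- x - - y)) = (\<lambda>y. f y * g (x - y))"
    proof
      fix y
      have "- x - - y = - (x - y)" by simp
      then show "f (- y) * g (- x - - y) = f y * g (x - y)"
        using even_densityD(4)[OF f, of y] even_densityD(4)[OF g, of "x - y"] by simp
    qed
    finally show ?thesis unfolding conv_def .
  qed
  have bdd: "bounded (range (conv f g))"
    unfolding bounded_iff using nonneg conv_le_bound[OF f g M] by (metis abs_of_nonneg rangeE real_norm_def)
  have int: "integrable lborel (conv f g)"
    using lborel_pair.integrable_snd[OF conv_pair_integrable[OF f g]]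
    unfolding conv_def[abs_def] by simp
  have "(\<integral>x. conv f g x \<partial>lborel) = (\<integral>y. (\<integral>x. f y * g (x - y) \<partial>lborel) \<partial>lborel)"
    unfolding conv_def
    using lborel_pair.Fubini_integral[OF conv_pair_integrable[OF f g]] by simp
  also have "\<dots> = 1"
    using even_densityD(3,5,6)[OF f] even_densityD(3,5,6)[OF g] by (simp add: lborel_integral_translate)
  finally show ?thesis
    using cont nonneg even bdd int unfolding even_density_def by simp
qed

text \<open>Fubini followed by a translation of the inner variable; a bound for \<open>h\<close>
  dominates the integrand by a multiple of the integrable pair function of \<open>f\<close> and
  \<open>g\<close>.\<close>

lemma conv_assoc:
  assumes f: "even_density f" and g: "even_density g" and h: "even_density h"
  shows "conv (conv f g) h x = conv f (conv g h) x"
proof -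
  note [measurable] = even_densityD(2)[OF f] even_densityD(2)[OF g] even_densityD(2)[OF h]
  obtain M where M: "\<And>x. h x \<le> M" using even_density_bound[OF h] by blast
  have int: "integrable (lborel \<Otimes>\<^sub>M lborel) (\<lambda>(z, y). f z * g (y - z) * h (x - y))"
  proof (rule Bochner_Integration.integrable_bound)
    show "integrable (lborel \<Otimes>\<^sub>M lborel) (\<lambda>p. M * (case p of (z, y) \<Rightarrow> f z * g (y - z)))"
      using conv_pair_integrable[OF f g] by simp
    show "AE p in lborel \<Otimes>\<^sub>M lborel. norm (case p of (z, y) \<Rightarrow> f z * g (y - z) * h (x - y))
       \<le> norm (M * (case p of (z, y) \<Rightarrow> f z * g (y - z)))"
    proof (intro AE_I2, clarify)
      fix z y
      have "\<bar>h (x - y)\<bar> \<le> \<bar>M\<bar>" using M[of "x - y"] even_densityD(3)[OF h, of "x - y"] by linarith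
      then have "\<bar>h (x - y)\<bar> * \<bar>f z * g (y - z)\<bar> \<le> \<bar>M\<bar> * \<bar>f z * g (y - z)\<bar>"
        by (rule mult_right_mono) simp
      then show "norm (f z * g (y - z) * h (x - y)) \<le> norm (M * (f z * g (y - z)))"
        by (simp add: abs_mult mult_ac)
    qed
  qed measurable
  have "conv (conv f g) h x = (\<integral>y. (\<integral>z. f z * g (y - z) * h (x - y) \<partial>lborel) \<partial>lborel)"
    unfolding conv_def by (intro Bochner_Integration.integral_cong) auto
  also have "\<dots> = (\<integral>z. (\<integral>y. f z * g (y - z) * h (x - y) \<partial>lborel) \<partial>lborel)"
    using lborel_pair.Fubini_integral[OF int] by simp
  also have "\<dots> = conv f (conv g h) x"
    unfolding conv_def
  proof (intro Bochner_Integration.integral_cong refl)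
    fix z
    have "(\<integral>y. g y * h (x - z - y) \<partial>lborel) = (\<integral>y. g (y - z) * h (x - y) \<partial>lborel)"
      using lborel_integral_translate(1)[of "\<lambda>y. g y * h (x - z - y)" z] by (simp add: algebra_simps)
    then show "(\<integral>y. f z * g (y - z) * h (x - y) \<partial>lborel) = f z * (\<integral>y. g y * h (x - z - y) \<partial>lborel)"
      by (simp add: mult.assoc)
  qed
  finally show ?thesis .
qed

section \<open>Convolution powers\<close>

text \<open>Index shift: \<open>conv_pow J n\<close> is the \<open>(n + 1)\<close>-fold convolution power.\<close>

definition conv_pow :: "('a::euclidean_space \<Rightarrow> real) \<Rightarrow> nat \<Rightarrow> 'a \<Rightarrow> real" where
  "conv_pow J n = (conv J ^^ n) J"

lemma conv_pow_0 [simp]: "conv_pow J 0 = J"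
  and conv_pow_Suc: "conv_pow J (Suc n) = conv J (conv_pow J n)"
  by (simp_all add: conv_pow_def)

lemma even_density_conv_pow: "even_density J \<Longrightarrow> even_density (conv_pow J n)"
  by (induction n) (auto simp: conv_pow_Suc conv_even_density)

lemma conv_conv_pow:
  assumes J: "even_density J"
  shows "conv (conv_pow J a) (conv_pow J b) = conv_pow J (Suc (a + b))"
proof (induction a)
  case (Suc a)
  have "conv (conv J (conv_pow J a)) (conv_pow J b) = conv J (conv (conv_pow J a) (conv_pow J b))"
    by (rule ext) (intro conv_assoc J even_density_conv_pow)
  then show ?case using Suc by (simp add: conv_pow_Suc)
qed (simp add: conv_pow_Suc)

section \<open>Decay of convolution powers\<close>

text \<open>Evenness of \<open>u\<close> makes the L2 inner product of two translates a value of the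
  convolution at the difference of the shifts.\<close>

lemma even_density_mult_translate:
  assumes u: "even_density u" and v: "even_density v"
  shows "integrable lborel (\<lambda>x. u (x - a) * v (x - b))"
    and "(\<integral>x. u (x - a) * v (x - b) \<partial>lborel) = conv u v (a - b)"
proof -
  note [measurable] = even_densityD(2)[OF u] even_densityD(2)[OF v]
  have eq: "u (x - a) * v (x - b) = u (a - x) * v ((a - b) - (a - x))" for x
    using even_densityD(4)[OF u, of "x - a"] by simp
  show "integrable lborel (\<lambda>x. u (x - a) * v (x - b))"
    unfolding eq
    by (subst lborel_integral_reflect(2)[of "\<lambda>y. u y * v ((a - b) - y)" a])
      (simp_all add: conv_integrable u v)
  show "(\<integral>x. u (x - a) * v (x - b) \<partial>lborel) = conv u v (a - b)"
    unfolding eq conv_def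
    by (subst lborel_integral_reflect(1)[of "\<lambda>y. u y * v ((a - b) - y)" a]) simp_all
qed

text \<open>Expanding the square: for \<open>q = conv u u\<close>, the drop of \<open>q\<close> from
  its value at 0 is half the squared L2 distance between two translates of \<open>u\<close>.\<close>

lemma conv_self_diff_eq:
  assumes u: "even_density u"
  shows "integrable lborel (\<lambda>x. (u (x - a) - u (x - b))\<^sup>2)"
    and "(\<integral>x. (u (x - a) - u (x - b))\<^sup>2 \<partial>lborel) = 2 * (conv u u 0 - conv u u (a - b))"
proof -
  have eq: "(u (x - a) - u (x - b))\<^sup>2 =
      u (x - a) * u (x - a) + u (x - b) * u (x - b) - 2 * (u (x - a) * u (x - b))" for x
    by (simp add: power2_eq_square algebra_simps)
  note int = even_density_mult_translate[OF u u]
  show "integrable lborel (\<lambda>x. (u (x - a) - u (x - b))\<^sup>2)"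
    unfolding eq using int by simp
  show "(\<integral>x. (u (x - a) - u (x - b))\<^sup>2 \<partial>lborel) = 2 * (conv u u 0 - conv u u (a - b))"
    unfolding eq using int(1)[of a a] int(1)[of b b] int(1)[of a b] by (simp add: int(2))
qed

lemma conv_self_le_0:
  assumes "even_density u"
  shows "conv u u x \<le> conv u u 0"
proof -
  have "0 \<le> (\<integral>y. (u (y - x) - u (y - 0))\<^sup>2 \<partial>lborel)" by simp
  then show ?thesis unfolding conv_self_diff_eq[OF assms] by simp
qed

text \<open>The triangle inequality for L2 distances of translates, in squared form: the translate
  by \<open>y\<close> is inserted as an intermediate point.\<close>

lemma conv_self_diff_add:
  assumes u: "even_density u"
  shows "conv u u 0 - conv u u (x + y) \<le> 2 * (conv u u 0 - conv u u x) + 2 * (conv u u 0 - conv u u y)"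
proof -
  have "(\<integral>z. (u (z - (x + y)) - u (z - 0))\<^sup>2 \<partial>lborel)
      \<le> (\<integral>z. 2 * (u (z - (x + y)) - u (z - y))\<^sup>2 + 2 * (u (z - y) - u (z - 0))\<^sup>2 \<partial>lborel)"
  proof (rule integral_mono)
    fix z
    have "(a + b)\<^sup>2 \<le> 2 * a\<^sup>2 + 2 * b\<^sup>2" for a b :: real
      using zero_le_power2[of "a - b"] by (simp add: power2_eq_square algebra_simps)
    from this[of "u (z - (x + y)) - u (z - y)" "u (z - y) - u (z - 0)"]
    show "(u (z - (x + y)) - u (z - 0))\<^sup>2
        \<le> 2 * (u (z - (x + y)) - u (z - y))\<^sup>2 + 2 * (u (z - y) - u (z - 0))\<^sup>2"
      by simp
  qed (intro Bochner_Integration.integrable_add integrable_mult_right conv_self_diff_eq(1)[OF u])+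
  also have "\<dots> = 2 * (\<integral>z. (u (z - (x + y)) - u (z - y))\<^sup>2 \<partial>lborel)
      + 2 * (\<integral>z. (u (z - y) - u (z - 0))\<^sup>2 \<partial>lborel)"
    by (subst Bochner_Integration.integral_add)
      (simp_all add: conv_self_diff_eq(1)[OF u] conv_self_diff_eq(1)[OF u, of _ 0, simplified])
  finally show ?thesis
    unfolding conv_self_diff_eq(2)[OF u] by simp
qed

text \<open>The value at 0 is the squared L2 norm of \<open>u\<close>; were it zero,
  \<open>u\<close> would vanish almost everywhere, against its mass 1.\<close>

lemma conv_self_pos:
  assumes u: "even_density u"
  shows "0 < conv u u 0"
proof (rule ccontr)
  note [measurable] = even_densityD(2)[OF u]
  have int: "integrable lborel (\<lambda>x. u x * u x)" and eq: "(\<integral>x. u x * u x \<partial>lborel) = conv u u 0"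
    using even_density_mult_translate[OF u u, of 0 0] by simp_all
  assume "\<not> 0 < conv u u 0"
  moreover have "0 \<le> (\<integral>x. u x * u x \<partial>lborel)" by simp
  ultimately have "(\<integral>x. u x * u x \<partial>lborel) = 0" using eq by linarith
  then have "AE x in lborel. u x = 0"
    using integral_nonneg_eq_0_iff_AE[OF int] by simp
  then have "(\<integral>x. u x \<partial>lborel) = 0"
    by (simp add: integral_eq_zero_AE)
  then show False using even_densityD(6)[OF u] by simp
qed

lemma conv_diff_eq:
  assumes k: "even_density k" and q: "even_density q"
  shows "integrable lborel (\<lambda>z. k z * (q 0 - q z))"
    and "(\<integral>z. k z * (q 0 - q z) \<partial>lborel) = q 0 - conv k q 0"
proof -
  have int: "integrable lborel (\<lambda>z. k z * q z)" and eq: "(\<integral>z. k z * q z \<partial>lborel) = conv k q 0"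
    using even_density_mult_translate[OF k q, of 0 0] by simp_all
  show "integrable lborel (\<lambda>z. k z * (q 0 - q z))"
    and "(\<integral>z. k z * (q 0 - q z) \<partial>lborel) = q 0 - conv k q 0"
    using int eq even_densityD(5,6)[OF k] by (simp_all add: right_diff_distrib)
qed

text \<open>The dissipation \<open>q 0 - (J * J * q) 0\<close> of the positive definite function \<open>q = u * u\<close> is the
  average of \<open>q 0 - q z\<close> against \<open>J * J\<close>, which is bounded below near the origin. It therefore
  controls the oscillation of \<open>q\<close> at every scale, and \<open>q\<close> cannot be large on a large ball as
  its integral is 1: a Nash inequality.\<close>

lemma conv_self_nash:
  fixes J :: "'a::euclidean_space \<Rightarrow> real"
  assumes J: "even_density J"
  obtains A B where "0 \<le> A" "0 \<le> B"
    "\<And>u j. even_density u \<Longrightarrow> conv u u 0 \<le> A / 2 ^ (j * DIM('a))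
       + B * 4 ^ j * (conv u u 0 - conv (conv J J) (conv u u) 0)"
proof -
  let ?K = "conv J J"
  have K: "even_density ?K" by (intro conv_even_density J)
  define c where "c = ?K 0 / 2"
  have c: "0 < c" using conv_self_pos[OF J] by (simp add: c_def)
  have "(?K \<longlongrightarrow> ?K 0) (nhds 0)"
    using even_densityD(1)[OF K] by (simp add: continuous_on_eq_continuous_at isCont_def tendsto_at_iff_tendsto_nhds)
  moreover have "c < ?K 0" using conv_self_pos[OF J] unfolding c_def by linarith
  ultimately have "eventually (\<lambda>z. c < ?K z) (nhds 0)" by (rule order_tendstoD(1))
  then obtain r where r: "0 < r" "\<And>z. dist z 0 < r \<Longrightarrow> c < ?K z"
    by (auto simp: eventually_nhds_metric)
  \<comment> \<open>Half of \<open>r\<close>, so that \<open>z\<close> and \<open>h - z\<close> both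
    stay where \<open>?K\<close> exceeds \<open>c\<close> whenever \<open>z\<close> and
    \<open>h\<close> lie in the ball of radius \<rho>.\<close>
  define \<rho> where "\<rho> = r / 2"
  have \<rho>: "0 < \<rho>" "\<And>z. norm z < 2 * \<rho> \<Longrightarrow> c < ?K z" using r by (auto simp: \<rho>_def)
  define V where "V = measure lborel (ball (0::'a) \<rho>)"
  have V: "0 < V" unfolding V_def using content_ball_pos[OF \<rho>(1)] by simp
  have ball_int: "integrable lborel (indicat_real (ball (0::'a) s))" for s
    using emeasure_lborel_ball_finite[of "0::'a" s] by simp
  have main: "conv u u 0 \<le> (1 / V) / 2 ^ (j * DIM('a))
       + 4 / (c * V) * 4 ^ j * (conv u u 0 - conv ?K (conv u u) 0)" if u: "even_density u" for u j
  proof -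
    define q where "q = conv u u"
    have q: "even_density q" unfolding q_def by (intro conv_even_density u)
    note [measurable] = even_densityD(2)[OF K] even_densityD(2)[OF q]
    define d where "d z = q 0 - q z" for z
    have d_nonneg: "0 \<le> d z" for z using conv_self_le_0[OF u] by (simp add: d_def q_def)
    have d_add: "d (x + y) \<le> 2 * d x + 2 * d y" for x y
      using conv_self_diff_add[OF u] by (simp add: d_def q_def)
    define E where "E = q 0 - conv ?K q 0"
    have Kd: "integrable lborel (\<lambda>z. ?K z * d z)" "(\<integral>z. ?K z * d z \<partial>lborel) = E"
      using conv_diff_eq[OF K q] by (simp_all add: d_def E_def)
    have "d \<in> borel_measurable borel" unfolding d_def by simp
    note [measurable] = this
    have Kd': "integrable lborel (\<lambda>z. ?K (h - z) * d (h - z))"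
         "(\<integral>z. ?K (h - z) * d (h - z) \<partial>lborel) = E" for h
      using lborel_integral_reflect[of "\<lambda>z. ?K z * d z" h] Kd by simp_all
    \<comment> \<open>Integrate \<open>d h \<le> 2 * d z + 2 * d (h - z)\<close> over
      \<open>z\<close> in the ball; after weighting by \<open>c\<close>, each of the two terms
      contributes at most \<open>2 * E\<close>.\<close>
    have small: "d h \<le> 4 / (c * V) * E" if h: "norm h < \<rho>" for h
    proof -
      have "(\<integral>z. indicat_real (ball (0::'a) \<rho>) z * (c * d h) \<partial>lborel)
          \<le> (\<integral>z. 2 * (?K z * d z) + 2 * (?K (h - z) * d (h - z)) \<partial>lborel)"
      proof (rule integral_mono)
        fix z :: 'a
        have nn: "0 \<le> ?K x * d x" for x by (intro mult_nonneg_nonneg even_densityD(3)[OF K] d_nonneg)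
        show "indicat_real (ball 0 \<rho>) z * (c * d h) \<le> 2 * (?K z * d z) + 2 * (?K (h - z) * d (h - z))"
        proof (cases "norm z < \<rho>")
          case True
          have "c < ?K z" using True \<rho> by simp
          moreover have "c < ?K (h - z)" using True h norm_triangle_ineq4[of h z] by (intro \<rho>) simp
          ultimately have "c * d z \<le> ?K z * d z" "c * d (h - z) \<le> ?K (h - z) * d (h - z)"
            by (auto intro!: mult_right_mono d_nonneg)
          moreover have "c * d h \<le> c * (2 * d z + 2 * d (h - z))"
            using d_add[of z "h - z"] c by simp
          ultimately show ?thesis using True by (simp add: algebra_simps)
        next
          case False
          then show ?thesis using nn[of z] nn[of "h - z"] by simp
        qed
      qed (use ball_int Kd Kd' in simp_all)
      also have "\<dots> = 4 * E" using Kd Kd' by simp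
      finally have "V * (c * d h) \<le> 4 * E" using ball_int by (simp add: V_def)
      then show ?thesis using c V by (simp add: field_simps)
    qed
    \<comment> \<open>Doubling the radius costs a factor 4, since \<open>d h\<close> is at most four
      times \<open>d\<close> at \<open>h / 2\<close>.\<close>
    have scaled: "d h \<le> 4 / (c * V) * 4 ^ j * E" if "norm h < 2 ^ j * \<rho>" for h
      using that
    proof (induction j arbitrary: h)
      case 0
      then show ?case using small by simp
    next
      case (Suc j)
      have "d (h /\<^sub>R 2) \<le> 4 / (c * V) * 4 ^ j * E"
        by (rule Suc.IH) (use Suc.prems in simp)
      moreover have "d h \<le> 4 * d (h /\<^sub>R 2)"
        using d_add[of "h /\<^sub>R 2" "h /\<^sub>R 2"] by (simp flip: scaleR_add_left)
      ultimately show ?case by simp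
    qed
    have Vj: "measure lborel (ball (0::'a) (2 ^ j * \<rho>)) = 2 ^ (j * DIM('a)) * V"
      using \<rho>(1) content_ball_conv_unit_ball[of "2 ^ j * \<rho>" "0::'a"] content_ball_conv_unit_ball[of \<rho> "0::'a"]
      by (simp add: V_def power_mult_distrib power_mult)
    \<comment> \<open>On this ball \<open>q\<close> is at least \<open>q 0\<close> minus the
      oscillation bound, while its total integral is 1; dividing by the volume of the ball bounds
      \<open>q 0\<close>.\<close>
    have "(\<integral>z. indicat_real (ball (0::'a) (2 ^ j * \<rho>)) z * (q 0 - 4 / (c * V) * 4 ^ j * E) \<partial>lborel)
        \<le> (\<integral>z. q z \<partial>lborel)"
    proof (rule integral_mono)
      fix z :: 'a
      show "indicat_real (ball 0 (2 ^ j * \<rho>)) z * (q 0 - 4 / (c * V) * 4 ^ j * E) \<le> q z"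
        using scaled[of z] even_densityD(3)[OF q, of z] by (auto simp: indicator_def d_def)
    qed (use ball_int even_densityD(5)[OF q] in simp_all)
    then have "2 ^ (j * DIM('a)) * V * (q 0 - 4 / (c * V) * 4 ^ j * E) \<le> 1"
      using ball_int even_densityD(6)[OF q] by (simp add: Vj)
    moreover have "0 < 2 ^ (j * DIM('a)) * V" using V by simp
    ultimately have "q 0 - 4 / (c * V) * 4 ^ j * E \<le> 1 / (2 ^ (j * DIM('a)) * V)"
      by (simp only: pos_le_divide_eq mult.commute)
    then show ?thesis unfolding E_def q_def by (simp add: mult.commute)
  qed
  show ?thesis
    by (rule that[of "1 / V" "4 / (c * V)"]) (use main c V in simp_all)
qed

text \<open>Summing the inequality over \<open>k\<close> from \<open>n\<close> to
  \<open>4 * n\<close> telescopes the dissipation. The scale \<open>j\<close> is free: taking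
  \<open>4 ^ j\<close> a small fixed fraction of \<open>n\<close> makes the normalised sequence
  \<open>2 ^ (i * N) * \<alpha> (4 ^ i)\<close> satisfy a recursion with contraction factor
  1/2.\<close>

lemma decay_of_dissipation:
  fixes \<alpha> :: "nat \<Rightarrow> real"
  assumes nonneg: "\<And>k. 0 \<le> \<alpha> k" and anti: "antimono \<alpha>" and A: "0 \<le> A" and B: "0 \<le> B"
    and diss: "\<And>k j. \<alpha> k \<le> A / 2 ^ (j * N) + B * 4 ^ j * (\<alpha> k - \<alpha> (Suc k))"
  obtains C where "0 \<le> C" "\<And>i. \<alpha> (4 ^ i) \<le> C / 2 ^ (i * N)"
proof -
  have step: "\<alpha> (4 * n) \<le> A / 2 ^ (j * N) + B * 4 ^ j / real n * \<alpha> n" if n: "0 < n" for n j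
  proof -
    have tele: "(\<Sum>k=n..<4 * n. \<alpha> k - \<alpha> (Suc k)) = \<alpha> n - \<alpha> (4 * n)"
      using sum_Suc_diff'[of n "4 * n" "\<lambda>k. - \<alpha> k"] by simp
    have "real (3 * n) * \<alpha> (4 * n) = (\<Sum>k=n..<4 * n. \<alpha> (4 * n))" by simp
    also have "\<dots> \<le> (\<Sum>k=n..<4 * n. \<alpha> k)"
      by (intro sum_mono antimonoD[OF anti]) simp
    also have "\<dots> \<le> (\<Sum>k=n..<4 * n. A / 2 ^ (j * N) + B * 4 ^ j * (\<alpha> k - \<alpha> (Suc k)))"
      by (intro sum_mono diss)
    also have "\<dots> = real (3 * n) * (A / 2 ^ (j * N)) + B * 4 ^ j * (\<alpha> n - \<alpha> (4 * n))"
      by (simp add: sum.distrib flip: sum_distrib_left tele)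
    \<comment> \<open>The second term is enlarged to three times
      \<open>B * 4 ^ j * \<alpha> n\<close> only so that \<open>3 * n\<close>, the number of
      summands, cancels.\<close>
    also have "\<dots> \<le> real (3 * n) * (A / 2 ^ (j * N)) + 3 * (B * 4 ^ j * \<alpha> n)"
    proof -
      have "B * 4 ^ j * (\<alpha> n - \<alpha> (4 * n)) \<le> B * 4 ^ j * \<alpha> n"
        using B nonneg[of "4 * n"] by (intro mult_left_mono) auto
      also have "\<dots> \<le> 3 * (B * 4 ^ j * \<alpha> n)" using B nonneg[of n] by simp
      finally show ?thesis by simp
    qed
    finally have "real (3 * n) * \<alpha> (4 * n) \<le> real (3 * n) * (A / 2 ^ (j * N) + B * 4 ^ j / real n * \<alpha> n)"
      using n by (simp add: distrib_left)
    then show ?thesis using n by (subst (asm) mult_le_cancel_left_pos) simp_all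
  qed
  \<comment> \<open>At scale \<open>j = i - s\<close> the coefficient of
    \<open>\<alpha> (4 ^ i)\<close> is \<open>B / 4 ^ s\<close>; it must absorb the growth
    \<open>2 ^ N\<close> of the normalisation and still leave 1/2.\<close>
  obtain s where "2 * 2 ^ N * B < 4 ^ s"
    using real_arch_pow[of 4 "2 * 2 ^ N * B"] by auto
  then have s: "B / 4 ^ s \<le> 1 / (2 * 2 ^ N)" by (simp add: field_simps)
  \<comment> \<open>The first summand is the fixed point of the recursion
    \<open>y = A * 2 ^ (Suc s * N) + y / 2\<close>; the second covers the indices up to
    \<open>s\<close>, where no scale \<open>i - s\<close> is available.\<close>
  define C where "C = 2 * A * 2 ^ (Suc s * N) + 2 ^ (s * N) * \<alpha> 0"
  have C: "0 \<le> C" using A nonneg by (simp add: C_def)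
  have "2 ^ (i * N) * \<alpha> (4 ^ i) \<le> C" for i
  proof (induction i)
    case 0
    have "\<alpha> 1 \<le> \<alpha> 0" using antimonoD[OF anti, of 0 1] by simp
    also have "\<dots> \<le> 2 ^ (s * N) * \<alpha> 0" using nonneg[of 0] by (simp add: mult_le_cancel_right1)
    also have "\<dots> \<le> C" using A by (simp add: C_def)
    finally show ?case by simp
  next
    case (Suc i)
    show ?case
    proof (cases "Suc i \<le> s")
      case True
      have "2 ^ (Suc i * N) * \<alpha> (4 ^ Suc i) \<le> 2 ^ (s * N) * \<alpha> 0"
        using True by (intro mult_mono power_increasing antimonoD[OF anti] nonneg) auto
      also have "\<dots> \<le> C" using A by (simp add: C_def)
      finally show ?thesis .
    next
      case False
      then obtain j where i: "i = s + j" by (metis le_Suc_ex not_less_eq_eq)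
      have "\<alpha> (4 ^ Suc i) \<le> A / 2 ^ (j * N) + B * 4 ^ j / 4 ^ i * \<alpha> (4 ^ i)"
        using step[of "4 ^ i" j] by simp
      also have "B * 4 ^ j / 4 ^ i = B / 4 ^ s" by (simp add: i power_add)
      also have "B / 4 ^ s * \<alpha> (4 ^ i) \<le> 1 / (2 * 2 ^ N) * \<alpha> (4 ^ i)"
        by (intro mult_right_mono s nonneg)
      finally have "2 ^ (Suc i * N) * \<alpha> (4 ^ Suc i)
          \<le> 2 ^ (Suc i * N) * (A / 2 ^ (j * N) + 1 / (2 * 2 ^ N) * \<alpha> (4 ^ i))"
        by (intro mult_left_mono) auto
      also have "\<dots> = A * 2 ^ (Suc s * N) + 2 ^ (i * N) * \<alpha> (4 ^ i) / 2"
        by (simp add: i power_add field_simps)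
      also have "\<dots> \<le> A * 2 ^ (Suc s * N) + C / 2" using Suc.IH by simp
      also have "\<dots> \<le> C" using nonneg[of 0] by (simp add: C_def)
      finally show ?thesis .
    qed
  qed
  then have "\<alpha> (4 ^ i) * 2 ^ (i * N) \<le> C" for i by (subst mult.commute)
  then have "\<alpha> (4 ^ i) \<le> C / 2 ^ (i * N)" for i by (simp add: pos_le_divide_eq)
  then show ?thesis using that C by blast
qed

text \<open>Index \<open>2 * k + 1\<close> is an even number of factors, hence an autocorrelation
  with its maximum at 0; further convolutions with the probability density \<open>J\<close> cannot
  raise the supremum.\<close>

lemma conv_pow_le_0:
  assumes J: "even_density J" and n: "2 * k + 1 \<le> n"
  shows "conv_pow J n x \<le> conv_pow J (2 * k + 1) 0"
  using n
proof (induction n arbitrary: x rule: dec_induct)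
  case base
  have "conv_pow J (2 * k + 1) = conv (conv_pow J k) (conv_pow J k)"
    by (simp add: conv_conv_pow[OF J] flip: mult_2)
  then show ?case using conv_self_le_0[OF even_density_conv_pow[OF J]] by simp
next
  case (step n)
  then show ?case unfolding conv_pow_Suc by (intro conv_le_bound even_density_conv_pow J)
qed

text \<open>This is decay of order \<open>n\<close> to the power \<open>- N / 2\<close>, with powers
  of 4 in place of real exponents. The Nash inequality gives it for the peaks \<alpha>, and
  \<open>conv_pow_le_0\<close> transfers it to all indices and points.\<close>

lemma conv_pow_decay:
  fixes J :: "'a::euclidean_space \<Rightarrow> real"
  assumes J: "even_density J"
  obtains C where "0 \<le> C" "\<And>n i x. 4 ^ i \<le> Suc n \<Longrightarrow> conv_pow J n x \<le> C / 2 ^ (i * DIM('a))"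
proof -
  let ?N = "DIM('a)"
  obtain A B where AB: "0 \<le> A" "0 \<le> B"
    and nash: "\<And>u j. even_density u \<Longrightarrow> conv u u 0 \<le> A / 2 ^ (j * ?N)
       + B * 4 ^ j * (conv u u 0 - conv (conv J J) (conv u u) 0)"
    using conv_self_nash[OF J] by blast
  define \<alpha> where "\<alpha> k = conv_pow J (2 * k + 1) 0" for k
  have "\<alpha> k \<le> A / 2 ^ (j * ?N) + B * 4 ^ j * (\<alpha> k - \<alpha> (Suc k))" for k j
  proof -
    \<comment> \<open>One more convolution with \<open>J * J\<close> raises the index by two, which
      is exactly the step from \<open>\<alpha> k\<close> to \<open>\<alpha> (Suc k)\<close>.\<close>
    have 1: "conv (conv_pow J k) (conv_pow J k) = conv_pow J (2 * k + 1)"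
      by (simp add: conv_conv_pow[OF J] flip: mult_2)
    have "conv J J = conv_pow J 1" by (simp add: conv_pow_Suc)
    then have 2: "conv (conv J J) (conv_pow J (2 * k + 1)) = conv_pow J (2 * Suc k + 1)"
      by (simp add: conv_conv_pow[OF J])
    show ?thesis using nash[OF even_density_conv_pow[OF J], of k j] unfolding 1 2 \<alpha>_def .
  qed
  moreover have "antimono \<alpha>"
    unfolding \<alpha>_def by (intro antimonoI conv_pow_le_0 J) simp
  moreover have "0 \<le> \<alpha> k" for k
    unfolding \<alpha>_def by (intro even_densityD even_density_conv_pow J)
  ultimately obtain C where C: "0 \<le> C" "\<And>i. \<alpha> (4 ^ i) \<le> C / 2 ^ (i * ?N)"
    using decay_of_dissipation[of \<alpha> A B ?N] AB by metis
  obtain M where M: "\<And>x. J x \<le> M" using even_density_bound[OF J] by blast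
  define D where "D = max M (C * 2 ^ ?N)"
  have "0 \<le> D" using C by (simp add: D_def max.coboundedI2)
  moreover have "conv_pow J n x \<le> D / 2 ^ (i * ?N)" if n: "4 ^ i \<le> Suc n" for n i x
  proof (cases i)
    case 0
    have "conv_pow J n x \<le> M" for n x
    proof (induction n arbitrary: x)
      case (Suc n)
      then show ?case unfolding conv_pow_Suc by (intro conv_le_bound even_density_conv_pow J)
    qed (simp add: M)
    then show ?thesis using 0 by (simp add: D_def max.coboundedI1)
  next
    case (Suc k)
    \<comment> \<open>The peak \<open>\<alpha> (4 ^ k)\<close> has index
      \<open>2 * 4 ^ k + 1\<close>, so one power of 4 is given up; the resulting factor
      \<open>2 ^ N\<close> is built into \<open>D\<close>.\<close>
    have "(1::nat) \<le> 4 ^ k" by simp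
    then have "2 * 4 ^ k + 1 \<le> n" using n unfolding Suc power_Suc by linarith
    then have "conv_pow J n x \<le> \<alpha> (4 ^ k)" unfolding \<alpha>_def by (rule conv_pow_le_0[OF J])
    also have "\<dots> \<le> C / 2 ^ (k * ?N)" by (rule C)
    also have "\<dots> = C * 2 ^ ?N / 2 ^ (i * ?N)" by (simp add: Suc power_add)
    also have "\<dots> \<le> D / 2 ^ (i * ?N)" by (intro divide_right_mono) (simp_all add: D_def)
    finally show ?thesis .
  qed
  ultimately show ?thesis using that by blast
qed

text \<open>In the diffusive region the weight is of order \<open>n\<close> to the power
  \<open>N / 2 + 1\<close>, and the decay of the convolution power leaves one factor
  \<open>n\<close>.\<close>

lemma conv_pow_near_bound:
  fixes J :: "'a::euclidean_space \<Rightarrow> real"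
  assumes J: "even_density J" and K: "0 \<le> K"
  obtains C where "0 \<le> C"
    "\<And>n x. (norm x)\<^sup>2 \<le> K * real (Suc n) \<Longrightarrow> norm x ^ (DIM('a) + 2) * conv_pow J n x \<le> C * real (Suc n)"
proof -
  let ?N = "DIM('a)"
  obtain C where C: "0 \<le> C" "\<And>n i x. 4 ^ i \<le> Suc n \<Longrightarrow> conv_pow J n x \<le> C / 2 ^ (i * ?N)"
    using conv_pow_decay[OF J] by blast
  \<comment> \<open>The factor 2 pays for rounding \<open>Suc n\<close> down to a power of 4: the
    norm of \<open>x\<close> is then at most \<open>L * 2 ^ i\<close>.\<close>
  define L where "L = 2 * sqrt K"
  have L: "0 \<le> L" using K by (simp add: L_def)
  have "norm x ^ (?N + 2) * conv_pow J n x \<le> L ^ (?N + 2) * C * real (Suc n)"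
    if x: "(norm x)\<^sup>2 \<le> K * real (Suc n)" for n and x :: 'a
  proof -
    obtain i where i: "4 ^ i \<le> Suc n" "Suc n < 4 ^ (i + 1)"
      using ex_power_ivl1[of 4 "Suc n"] by auto
    have i': "real (Suc n) \<le> 4 * 4 ^ i" "4 ^ i \<le> real (Suc n)"
      using i by (simp_all flip: of_nat_le_iff[where 'a=real] of_nat_less_iff[where 'a=real])
    have "(norm x)\<^sup>2 \<le> K * (4 * 4 ^ i)"
      using x mult_left_mono[OF i'(1) K] by linarith
    also have "K * (4 * 4 ^ i) = (L * 2 ^ i)\<^sup>2"
    proof -
      have "(4::real) ^ i = 2 ^ i * 2 ^ i" by (simp flip: power_mult_distrib)
      moreover have "K = sqrt K * sqrt K" using K by simp
      ultimately show ?thesis by (simp only: L_def power2_eq_square) (simp add: mult_ac)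
    qed
    finally have "norm x \<le> L * 2 ^ i" using L by (simp add: power2_le_iff_abs_le)
    then have "norm x ^ (?N + 2) * conv_pow J n x \<le> (L * 2 ^ i) ^ (?N + 2) * (C / 2 ^ (i * ?N))"
      using i L even_densityD(3)[OF even_density_conv_pow[OF J], of n x]
      by (intro mult_mono power_mono C) auto
    also have "\<dots> = L ^ (?N + 2) * C * 4 ^ i"
    proof -
      have "(L * t) ^ (?N + 2) * (C / t ^ ?N) = L ^ (?N + 2) * C * (t * t)" if "t \<noteq> 0" for t
        using that by (simp add: power_mult_distrib power_add power2_eq_square field_simps)
      moreover have "(4::real) ^ i = 2 ^ i * 2 ^ i" by (simp flip: power_mult_distrib)
      ultimately show ?thesis by (simp only: power_mult power_not_zero zero_neq_numeral not_False_eq_True)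
    qed
    also have "\<dots> \<le> L ^ (?N + 2) * C * real (Suc n)"
      using L C i' by (intro mult_left_mono) auto
    finally show ?thesis .
  qed
  then show ?thesis using that[of "L ^ (?N + 2) * C"] L C by simp
qed

section \<open>Tails of convolution powers\<close>

text \<open>A Taylor bound with exact linear term, by induction on \<open>m\<close>: each step
  divides by \<open>1 - b\<close>.\<close>

lemma inverse_power_quadratic_bound:
  obtains c :: real where "0 \<le> c" "\<And>b. \<bar>b\<bar> \<le> 1 / 2 \<Longrightarrow> 1 / (1 - b) ^ m \<le> 1 + real m * b + c * b\<^sup>2"
proof -
  have "\<exists>c\<ge>0. \<forall>b::real. \<bar>b\<bar> \<le> 1 / 2 \<longrightarrow> 1 / (1 - b) ^ m \<le> 1 + real m * b + c * b\<^sup>2"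
  proof (induction m)
    case (Suc m)
    then obtain c where c: "0 \<le> c" "\<And>b::real. \<bar>b\<bar> \<le> 1 / 2 \<Longrightarrow> 1 / (1 - b) ^ m \<le> 1 + real m * b + c * b\<^sup>2"
      by blast
    \<comment> \<open>After multiplying out \<open>1 - b\<close>, the surplus is
      \<open>b\<^sup>2\<close> times \<open>c' - c - (m + 1) - c' * b\<close>; this choice makes the
      latter factor vanish at the worst case \<open>b = 1 / 2\<close>.\<close>
    define c' where "c' = 2 * c + 2 * real m + 2"
    have "1 / (1 - b) ^ Suc m \<le> 1 + real (Suc m) * b + c' * b\<^sup>2" if b: "\<bar>b\<bar> \<le> 1 / 2" for b :: real
    proof -
      have pos: "0 < 1 - b" using b by (auto simp: abs_le_iff)
      have "1 / (1 - b) ^ Suc m = 1 / (1 - b) ^ m / (1 - b)" by simp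
      also have "\<dots> \<le> (1 + real m * b + c * b\<^sup>2) / (1 - b)"
        using c(2)[OF b] pos by (intro divide_right_mono) auto
      also have "\<dots> \<le> 1 + real (Suc m) * b + c' * b\<^sup>2"
      proof -
        have "0 \<le> b\<^sup>2 * (c' - c - real (Suc m) - c' * b)"
        proof -
          have "c' * b \<le> c' * (1 / 2)" using b c(1) by (intro mult_left_mono) (auto simp: c'_def)
          then have "0 \<le> c' - c - real (Suc m) - c' * b" by (simp add: c'_def)
          then show ?thesis by simp
        qed
        then have "1 + real m * b + c * b\<^sup>2 \<le> (1 + real (Suc m) * b + c' * b\<^sup>2) * (1 - b)"
          by (simp add: algebra_simps power2_eq_square)
        then show ?thesis using pos by (simp add: pos_divide_le_eq)
      qed
      finally show ?thesis .
    qed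
    moreover have "0 \<le> c'" using c by (simp add: c'_def)
    ultimately show ?case by blast
  qed (auto intro!: exI[of _ 0])
  then show ?thesis using that by blast
qed

text \<open>Since \<open>J\<close> is even, the first-order term of \<open>|x - z|\<^sup>-\<^sup>m\<close> averages out; the
  inequality \<open>|x - z| \<ge> |x| (1 - x \<bullet> z / |x|\<^sup>2)\<close> avoids expanding the norm.\<close>

lemma conv_weighted_bound:
  fixes J :: "'a::euclidean_space \<Rightarrow> real"
  assumes J: "even_density J" and supp: "\<And>z. R < norm z \<Longrightarrow> J z = 0" and R: "0 \<le> R"
    and c: "0 \<le> c" "\<And>b. \<bar>b\<bar> \<le> 1 / 2 \<Longrightarrow> 1 / (1 - b) ^ m \<le> 1 + real m * b + c * b\<^sup>2"
    and g: "even_density g" and D: "\<And>y. norm y ^ m * g y \<le> D"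
    and x: "x \<noteq> 0" "2 * R \<le> norm x"
  shows "norm x ^ m * conv J g x \<le> D * (1 + c * R\<^sup>2 / (norm x)\<^sup>2)"
proof -
  note [measurable] = even_densityD(2)[OF J]
  have D0: "0 \<le> D" using D[of x] even_densityD(3)[OF g, of x] x by (meson mult_nonneg_nonneg norm_ge_zero order_trans zero_le_power)
  define \<beta> where "\<beta> z = (x \<bullet> z) / (norm x)\<^sup>2" for z
  have [measurable]: "\<beta> \<in> borel_measurable borel" unfolding \<beta>_def by simp
  have \<beta>: "\<bar>\<beta> z\<bar> \<le> R / norm x" if "norm z \<le> R" for z
  proof -
    have "\<bar>x \<bullet> z\<bar> \<le> norm x * R"
      using Cauchy_Schwarz_ineq2[of x z] mult_left_mono[OF that, of "norm x"] by simp
    then have "\<bar>x \<bullet> z\<bar> / (norm x)\<^sup>2 \<le> norm x * R / (norm x)\<^sup>2" by (rule divide_right_mono) simp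
    then show ?thesis using x by (simp add: \<beta>_def abs_divide power2_eq_square)
  qed
  have Rx: "R / norm x \<le> 1 / 2" using x by (simp add: field_simps)
  have J\<beta>: "integrable lborel (\<lambda>z. J z * \<beta> z)"
  proof (rule Bochner_Integration.integrable_bound)
    show "integrable lborel (\<lambda>z. R / norm x * J z)" using even_densityD(5)[OF J] by simp
    show "AE z in lborel. norm (J z * \<beta> z) \<le> norm (R / norm x * J z)"
    proof (intro AE_I2)
      fix z
      show "norm (J z * \<beta> z) \<le> norm (R / norm x * J z)"
      proof (cases "norm z \<le> R")
        case True
        then show ?thesis
          using mult_right_mono[OF \<beta>[OF True], of "\<bar>J z\<bar>"] R by (simp add: abs_mult abs_divide mult.commute)
      qed (simp add: supp)
    qed
  qed simp
  \<comment> \<open>The reflection of \<open>z\<close> flips the sign of \<beta> but not of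
    \<open>J\<close>, so the first moment vanishes.\<close>
  have "(\<integral>z. J z * \<beta> z \<partial>lborel) = (\<integral>z. J (0 - z) * \<beta> (0 - z) \<partial>lborel)"
    by (rule lborel_integral_reflect(1)[symmetric]) simp
  also have "\<dots> = - (\<integral>z. J z * \<beta> z \<partial>lborel)"
    by (simp add: even_densityD(4)[OF J] \<beta>_def)
  finally have zero: "(\<integral>z. J z * \<beta> z \<partial>lborel) = 0" by simp
  have "norm x ^ m * conv J g x = (\<integral>z. norm x ^ m * (J z * g (x - z)) \<partial>lborel)"
    by (simp add: conv_def)
  also have "\<dots> \<le> (\<integral>z. D * (1 + c * R\<^sup>2 / (norm x)\<^sup>2) * J z + D * real m * (J z * \<beta> z) \<partial>lborel)"
  proof (rule integral_mono)
    fix z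
    show "norm x ^ m * (J z * g (x - z))
      \<le> D * (1 + c * R\<^sup>2 / (norm x)\<^sup>2) * J z + D * real m * (J z * \<beta> z)"
    proof (cases "norm z \<le> R")
      case True
      have b: "\<bar>\<beta> z\<bar> \<le> 1 / 2" using \<beta>[OF True] Rx by linarith
      then have pos: "0 < 1 - \<beta> z" by (auto simp: abs_le_iff)
      have "(norm x)\<^sup>2 * (1 - \<beta> z) = x \<bullet> (x - z)"
        using x by (simp add: \<beta>_def algebra_simps power2_norm_eq_inner)
      also have "\<dots> \<le> norm x * norm (x - z)" by (rule norm_cauchy_schwarz)
      finally have "norm x * (1 - \<beta> z) \<le> norm (x - z)"
        using x by (simp add: power2_eq_square mult.assoc)
      then have "(norm x * (1 - \<beta> z)) ^ m * g (x - z) \<le> norm (x - z) ^ m * g (x - z)"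
        using pos by (intro mult_right_mono power_mono even_densityD(3)[OF g]) auto
      also have "\<dots> \<le> D" by (rule D)
      finally have "norm x ^ m * g (x - z) * (1 - \<beta> z) ^ m \<le> D"
        by (simp add: power_mult_distrib mult_ac)
      then have "norm x ^ m * g (x - z) \<le> D * (1 / (1 - \<beta> z) ^ m)"
        using pos by (simp add: pos_le_divide_eq)
      also have "\<dots> \<le> D * (1 + real m * \<beta> z + c * (\<beta> z)\<^sup>2)"
        by (intro mult_left_mono c b D0)
      also have "\<dots> \<le> D * (1 + real m * \<beta> z + c * (R / norm x)\<^sup>2)"
        using \<beta>[OF True] R x by (intro mult_left_mono add_left_mono D0 c) (simp add: power2_le_iff_abs_le)
      finally have "J z * (norm x ^ m * g (x - z)) \<le> J z * (D * (1 + real m * \<beta> z + c * (R / norm x)\<^sup>2))"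
        by (intro mult_left_mono even_densityD(3)[OF J])
      then show ?thesis by (simp add: algebra_simps power_divide)
    qed (simp add: supp)
  qed (use J\<beta> conv_integrable[OF J g] even_densityD(5)[OF J] in simp_all)
  also have "\<dots> = D * (1 + c * R\<^sup>2 / (norm x)\<^sup>2)"
    using J\<beta> zero even_densityD(5,6)[OF J] by simp
  finally show ?thesis .
qed

text \<open>The near bound holds for every \<open>n\<close> separately, so the induction step
  concerns only far points. There the averaging loss adds at most \<open>C\<close> to
  \<open>C * real (Suc n)\<close>, and the same \<open>C\<close> serves throughout.\<close>

lemma conv_pow_moment_bound:
  fixes J :: "'a::euclidean_space \<Rightarrow> real"
  assumes J: "even_density J" and supp: "\<And>z. R < norm z \<Longrightarrow> J z = 0" and R: "0 \<le> R"
  obtains C where "0 \<le> C" "\<And>n x. norm x ^ (DIM('a) + 2) * conv_pow J n x \<le> C * real (Suc n)"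
proof -
  let ?m = "DIM('a) + 2"
  obtain c :: real where c: "0 \<le> c" "\<And>b. \<bar>b\<bar> \<le> 1 / 2 \<Longrightarrow> 1 / (1 - b) ^ ?m \<le> 1 + real ?m * b + c * b\<^sup>2"
    using inverse_power_quadratic_bound by blast
  \<comment> \<open>Outside the near region the first summand forces
    \<open>2 * R \<le> norm x\<close>, the second keeps the averaging loss at most 1, and the third
    makes \<open>K\<close> positive.\<close>
  define K where "K = (2 * R)\<^sup>2 + c * R\<^sup>2 + 1"
  have cR: "0 \<le> c * R\<^sup>2" using c by simp
  have K: "0 < K" "(2 * R)\<^sup>2 \<le> K" "c * R\<^sup>2 \<le> K"
    using cR unfolding K_def by (auto intro: add_nonneg_pos)
  obtain C where C: "0 \<le> C"
    and near: "\<And>n x. (norm x)\<^sup>2 \<le> K * real (Suc n) \<Longrightarrow> norm x ^ ?m * conv_pow J n x \<le> C * real (Suc n)"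
    using conv_pow_near_bound[OF J, of K] K by (metis less_imp_le)
  have far: "x \<noteq> 0" "2 * R \<le> norm x" if x: "\<not> (norm x)\<^sup>2 \<le> K * real (Suc n)" for n and x :: 'a
  proof -
    have *: "K \<le> K * real (Suc n)" using K by simp
    then show "x \<noteq> 0" using x K by auto
    have "(2 * R)\<^sup>2 \<le> (norm x)\<^sup>2" using * x K by linarith
    then show "2 * R \<le> norm x" by (rule power2_le_imp_le) simp
  qed
  have "norm x ^ ?m * conv_pow J n x \<le> C * real (Suc n)" for n x
  proof (induction n arbitrary: x)
    case 0
    show ?case
    proof (cases "(norm x)\<^sup>2 \<le> K * real (Suc 0)")
      case False
      \<comment> \<open>A far point lies outside the support of \<open>J\<close>; for
        \<open>R = 0\<close> this rests on \<open>x \<noteq> 0\<close>.\<close>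
      have "R < norm x" using far[OF False] R by (cases "R = 0") auto
      then show ?thesis using C by (simp add: supp)
    qed (rule near)
  next
    case (Suc n)
    show ?case
    proof (cases "(norm x)\<^sup>2 \<le> K * real (Suc (Suc n))")
      case False
      have "norm x ^ ?m * conv_pow J (Suc n) x \<le> C * real (Suc n) * (1 + c * R\<^sup>2 / (norm x)\<^sup>2)"
        unfolding conv_pow_Suc
        by (rule conv_weighted_bound[OF J supp R c even_density_conv_pow[OF J] Suc.IH far[OF False]])
      also have "\<dots> = C * (real (Suc n) + real (Suc n) * (c * R\<^sup>2) / (norm x)\<^sup>2)"
        by (simp add: algebra_simps)
      also have "\<dots> \<le> C * real (Suc (Suc n))"
      proof (intro mult_left_mono C)
        have "real (Suc n) * (c * R\<^sup>2) \<le> real (Suc (Suc n)) * K"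
          using K cR by (intro mult_mono) auto
        also have "\<dots> \<le> (norm x)\<^sup>2" using False by (simp add: mult.commute)
        finally have "real (Suc n) * (c * R\<^sup>2) / (norm x)\<^sup>2 \<le> 1"
          using far[OF False] by simp
        then show "real (Suc n) + real (Suc n) * (c * R\<^sup>2) / (norm x)\<^sup>2 \<le> real (Suc (Suc n))" by simp
      qed
      finally show ?thesis .
    qed (rule near)
  qed
  then show ?thesis using that C by blast
qed

section \<open>The nonlocal diffusion equation\<close>

lemma compactly_supported_norm_bound:
  assumes "compactly_supported J"
  obtains R where "0 \<le> R" "\<And>z. R < norm z \<Longrightarrow> J z = 0"
proof -
  have "bounded (closure {x. J x \<noteq> 0})"
    using assms by (simp add: compactly_supported_def compact_imp_bounded)
  then obtain R where R: "0 < R" "\<forall>x\<in>closure {x. J x \<noteq> 0}. norm x \<le> R"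
    by (auto simp: bounded_pos)
  show ?thesis
  proof (rule that)
    show "J z = 0" if z: "R < norm z" for z
    proof (rule ccontr)
      assume "J z \<noteq> 0"
      then have "z \<in> closure {x. J x \<noteq> 0}" using closure_subset[of "{x. J x \<noteq> 0}"] by auto
      with R(2) have "norm z \<le> R" by (rule bspec)
      with z show False by simp
    qed
  qed (use R(1) in simp)
qed

lemma even_densityI:
  fixes J :: "'a::euclidean_space \<Rightarrow> real"
  assumes cont: "continuous_on UNIV J" and supp: "compactly_supported J"
    and rad: "radially_symmetric J" and nonneg: "\<And>x. J x \<ge> 0" and one: "integral\<^sup>L lborel J = 1"
  shows "even_density J"
proof -
  have "compact (J ` closure {x. J x \<noteq> 0})"
    using supp cont by (intro compact_continuous_image) (auto simp: compactly_supported_def intro: continuous_on_subset)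
  then have "bounded (insert 0 (J ` closure {x. J x \<noteq> 0}))"
    using compact_imp_bounded by simp
  moreover have "range J \<subseteq> insert 0 (J ` closure {x. J x \<noteq> 0})"
    using closure_subset[of "{x. J x \<noteq> 0}"] by auto
  ultimately have "bounded (range J)" by (rule bounded_subset)
  \<comment> \<open>The Bochner integral of a non-integrable function is 0 by convention, so
    integral 1 forces integrability.\<close>
  moreover have "integrable lborel J" using one not_integrable_integral_eq[of lborel J] by (metis zero_neq_one)
  moreover have "J (- x) = J x" for x
    using rad norm_minus_cancel[of x] unfolding radially_symmetric_def by blast
  ultimately show ?thesis using cont nonneg one by (simp add: even_density_def)
qed

text \<open>The reflection of \<open>y\<close> about \<open>x\<close> gives the convolution, and
  mass 1 gives the term \<open>- u x\<close>. It is stated for bounded measurable \<open>u\<close>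
  so that it applies to time slices of \<open>W\<close>.\<close>

lemma nonlocal_op_eq_conv:
  assumes J: "even_density J" and [measurable]: "u \<in> borel_measurable borel" and M: "\<And>x. \<bar>u x\<bar> \<le> M"
  shows "nonlocal_op J u x = conv J u x - u x"
proof -
  note [measurable] = even_densityD(2)[OF J]
  have int: "integrable lborel (\<lambda>y. J y * u (x - y))"
    by (rule integrable_mult_bounded[OF even_densityD(5)[OF J] _ M]) simp
  have "nonlocal_op J u x = (\<integral>y. J (x - (x - y)) * (u (x - y) - u x) \<partial>lborel)"
    unfolding nonlocal_op_def
    by (rule lborel_integral_reflect(1)[symmetric]) simp
  also have "\<dots> = conv J u x - u x"
    using int even_densityD(5,6)[OF J] by (simp add: right_diff_distrib conv_def)
  finally show ?thesis .
qed

text \<open>Meant for \<open>u = exp s * W\<close> at a fixed time and \<open>v\<close> a partial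
  sum plus a constant; neither is assumed to be a density.\<close>

lemma conv_mono:
  assumes J: "even_density J" and [measurable]: "u \<in> borel_measurable borel" and M: "\<And>x. \<bar>u x\<bar> \<le> M"
    and v: "integrable lborel (\<lambda>y. J y * v (x - y))" and le: "\<And>y. u y \<le> v y"
  shows "conv J u x \<le> conv J v x"
  unfolding conv_def
proof (rule integral_mono[OF _ v])
  show "integrable lborel (\<lambda>y. J y * u (x - y))"
    by (rule integrable_mult_bounded[OF even_densityD(5)[OF J] _ M]) simp
qed (intro mult_left_mono le even_densityD(3)[OF J])

section \<open>Comparison of \<open>W\<close> with the exponential series of convolution
  powers\<close>

text \<open>Since \<open>W\<close> is \<open>exp (- t)\<close> times the series \<open>\<Sum>k\<ge>1. t ^ k / k! * J\<^sup>*\<^sup>k\<close>, the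
  derivative of the difference of \<open>exp t * W\<close> and the \<open>n\<close>-th partial sum is the convolution with
  \<open>J\<close> of the previous difference, and the remainder decays like \<open>t ^ n / n!\<close>.\<close>

lemma fundamental_smooth_part_le_partial_sum:
  assumes J: "even_density J" and W: "fundamental_smooth_part J W"
    and M: "\<And>x t. 0 \<le> t \<Longrightarrow> t \<le> T \<Longrightarrow> \<bar>exp t * W x t\<bar> \<le> M"
    and t: "0 \<le> t" "t \<le> T"
  shows "exp t * W x t \<le> (\<Sum>k<n. t ^ Suc k / fact (Suc k) * conv_pow J k x) + M * (t ^ n / fact n)"
  using t
proof (induction n arbitrary: x t)
  case 0
  then show ?case using M[of t x] by (simp add: abs_le_iff)
next
  case (Suc n)
  have cont: "continuous_on (UNIV \<times> {0..}) (\<lambda>(x, t). W x t)"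
    and deriv: "\<And>x t. 0 < t \<Longrightarrow> ((\<lambda>s. W x s) has_real_derivative
        (nonlocal_op J (\<lambda>y. W y t) x + exp (- t) * J x)) (at t)"
    and zero: "W x 0 = 0"
    using W by (auto simp: fundamental_smooth_part_def)
  define F where "F s = (\<Sum>k<Suc n. s ^ Suc k / fact (Suc k) * conv_pow J k x)
      + M * (s ^ Suc n / fact (Suc n)) - exp s * W x s" for s
  \<comment> \<open>\<open>F\<close> is the claimed bound minus \<open>exp s * W x s\<close>. It
    starts at 0, and its derivative is nonnegative at positive times; continuity up to time 0 links
    the two.\<close>
  have "F 0 \<le> F t"
  proof (rule DERIV_nonneg_imp_increasing_open[OF Suc.prems(1)])
    have "continuous_on {0..t} ((\<lambda>(x, t). W x t) \<circ> (\<lambda>s. (x, s)))"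
      by (intro continuous_on_compose continuous_on_subset[OF cont] continuous_intros) auto
    then have "continuous_on {0..t} (W x)" by (simp add: o_def)
    then show "continuous_on {0..t} F" unfolding F_def by (intro continuous_intros) auto
  next
    fix s assume s: "0 < s" "s < t"
    then have sT: "0 \<le> s" "s \<le> T" using Suc.prems by simp_all
    define V where "V y = exp s * W y s" for y
    have "continuous_on UNIV ((\<lambda>(x, t). W x t) \<circ> (\<lambda>y. (y, s)))"
      using s by (intro continuous_on_compose continuous_on_subset[OF cont] continuous_intros) auto
    then have Wcont: "continuous_on UNIV (\<lambda>y. W y s)" by (simp add: o_def)
    then have [measurable]: "(\<lambda>y. W y s) \<in> borel_measurable borel"
      by (rule borel_measurable_continuous_onI)
    have [measurable]: "V \<in> borel_measurable borel" unfolding V_def by simp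
    have "\<bar>W y s\<bar> \<le> exp (- s) * M" for y
      using M[OF sT, of y] by (simp add: abs_mult exp_minus field_simps)
    then have op: "nonlocal_op J (\<lambda>y. W y s) x = conv J (\<lambda>y. W y s) x - W x s"
      by (intro nonlocal_op_eq_conv[OF J]) simp_all
    have convV: "conv J V x = exp s * conv J (\<lambda>y. W y s) x"
      unfolding conv_def V_def by (subst integral_mult_right_zero[symmetric]) (simp add: mult_ac)
    have dpow: "((\<lambda>s. s ^ Suc k / fact (Suc k)) has_real_derivative s ^ k / fact k) (at s)" for k
    proof -
      have "((\<lambda>s. s ^ Suc k / fact (Suc k)) has_real_derivative real (Suc k) * s ^ k / fact (Suc k)) (at s)"
        using DERIV_cdivide[OF DERIV_pow[of "Suc k" s UNIV], of "fact (Suc k)"] by simp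
      moreover have "real (Suc k) * s ^ k / fact (Suc k) = s ^ k / fact k"
        by (simp add: field_simps del: of_nat_Suc)
      ultimately show ?thesis by simp
    qed
    have dW: "((\<lambda>s. exp s * W x s) has_real_derivative conv J V x + J x) (at s)"
    proof -
      have "((\<lambda>s. exp s * W x s) has_real_derivative
          exp s * W x s + (nonlocal_op J (\<lambda>y. W y s) x + exp (- s) * J x) * exp s) (at s)"
        by (rule DERIV_mult[OF DERIV_exp deriv[OF s(1)]])
      moreover have "exp s * W x s + (nonlocal_op J (\<lambda>y. W y s) x + exp (- s) * J x) * exp s
          = conv J V x + J x"
        unfolding op convV by (simp add: algebra_simps flip: exp_add)
      ultimately show ?thesis by simp
    qed
    have dF: "(F has_real_derivative (\<Sum>k<Suc n. s ^ k / fact k * conv_pow J k x)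
        + M * (s ^ n / fact n) - (conv J V x + J x)) (at s)"
      unfolding F_def[abs_def]
      by (intro DERIV_diff DERIV_add DERIV_sum DERIV_cmult DERIV_cmult_right dpow dW)
    \<comment> \<open>This is the bound for \<open>n\<close> at time \<open>s\<close>. Its
      convolution with \<open>J\<close>, plus \<open>J x\<close>, is the derivative of the bound for
      \<open>Suc n\<close>.\<close>
    let ?v = "\<lambda>y. (\<Sum>k<n. s ^ Suc k / fact (Suc k) * conv_pow J k y) + M * (s ^ n / fact n)"
    have v_eq: "J y * ?v (x - y) = (\<Sum>k<n. s ^ Suc k / fact (Suc k) * (J y * conv_pow J k (x - y)))
        + M * (s ^ n / fact n) * J y" for y
      by (simp add: distrib_left sum_distrib_left mult_ac del: fact_Suc power_Suc)
    have int: "integrable lborel (\<lambda>y. J y * conv_pow J k (x - y))" for k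
      by (intro conv_integrable J even_density_conv_pow)
    have v_int: "integrable lborel (\<lambda>y. J y * ?v (x - y))"
      unfolding v_eq using int even_densityD(5)[OF J]
      by (intro Bochner_Integration.integrable_add Bochner_Integration.integrable_sum integrable_mult_right) auto
    have "conv J V x \<le> conv J ?v x"
    proof (rule conv_mono[OF J _ _ v_int])
      show "\<bar>V y\<bar> \<le> M" for y unfolding V_def by (rule M[OF sT])
      show "V y \<le> ?v y" for y unfolding V_def by (rule Suc.IH[OF sT])
    qed simp
    also have "\<dots> = (\<Sum>k<n. s ^ Suc k / fact (Suc k) * conv_pow J (Suc k) x) + M * (s ^ n / fact n)"
      unfolding conv_def[of J ?v] v_eq using int even_densityD(5,6)[OF J]
      by (subst Bochner_Integration.integral_add)
        (simp_all add: Bochner_Integration.integral_sum conv_pow_Suc conv_def del: fact_Suc power_Suc)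
    \<comment> \<open>The forcing term supplies the missing term \<open>k = 0\<close> of the shifted
      sum.\<close>
    also have "\<dots> + J x = (\<Sum>k<Suc n. s ^ k / fact k * conv_pow J k x) + M * (s ^ n / fact n)"
      by (subst sum.lessThan_Suc_shift) simp
    finally show "\<exists>y. (F has_real_derivative y) (at s) \<and> 0 \<le> y"
      using dF by (intro exI conjI) auto
  qed
  moreover have "F 0 = 0" by (simp add: F_def zero)
  ultimately show ?case by (simp add: F_def del: sum.lessThan_Suc)
qed

text \<open>The moment bound cancels one factor of each factorial, so the weighted partial sums stay
  below \<open>C * t * exp t\<close>. The remainder vanishes as \<open>n\<close> tends to infinity,
  and \<open>exp t\<close> cancels.\<close>

lemma fundamental_smooth_part_bound:
  fixes J :: "'a::euclidean_space \<Rightarrow> real"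
  assumes J: "even_density J" and W: "fundamental_smooth_part J W"
    and C: "0 \<le> C" "\<And>n. norm x ^ m * conv_pow J n x \<le> C * real (Suc n)"
    and x: "x \<noteq> 0" and t: "0 < t"
  shows "W x t \<le> C * (t / norm x ^ m)"
proof -
  have "\<exists>M. \<forall>x. \<forall>s\<in>{0..t}. \<bar>W x s\<bar> \<le> M"
    using W t unfolding fundamental_smooth_part_def by blast
  then obtain M0 where "\<forall>x. \<forall>s\<in>{0..t}. \<bar>W x s\<bar> \<le> M0" by blast
  then have M0: "\<bar>W x s\<bar> \<le> M0" if "0 \<le> s" "s \<le> t" for x s using that by simp
  have M: "\<bar>exp s * W y s\<bar> \<le> exp t * M0" if "0 \<le> s" "s \<le> t" for y s
    unfolding abs_mult using that M0[OF that, of y] by (intro mult_mono) auto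
  have "norm x ^ m * (exp t * W x t) \<le> C * t * exp t + norm x ^ m * (exp t * M0) * (t ^ n / fact n)" for n
  proof -
    have "norm x ^ m * (exp t * W x t) \<le> norm x ^ m *
        ((\<Sum>k<n. t ^ Suc k / fact (Suc k) * conv_pow J k x) + exp t * M0 * (t ^ n / fact n))"
      using t by (intro mult_left_mono fundamental_smooth_part_le_partial_sum[OF J W M]) auto
    also have "\<dots> = (\<Sum>k<n. t ^ Suc k / fact (Suc k) * (norm x ^ m * conv_pow J k x))
        + norm x ^ m * (exp t * M0) * (t ^ n / fact n)"
      by (simp add: distrib_left sum_distrib_left mult_ac del: fact_Suc power_Suc)
    also have "(\<Sum>k<n. t ^ Suc k / fact (Suc k) * (norm x ^ m * conv_pow J k x))
        \<le> (\<Sum>k<n. t ^ Suc k / fact (Suc k) * (C * real (Suc k)))"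
      using t by (intro sum_mono mult_left_mono C) auto
    also have "\<dots> = (\<Sum>k<n. C * t * (t ^ k / fact k))"
      by (intro sum.cong) (simp_all add: field_simps del: of_nat_Suc)
    also have "\<dots> = C * t * (\<Sum>k<n. t ^ k / fact k)"
      by (simp add: sum_distrib_left)
    also have "\<dots> \<le> C * t * exp t"
    proof (intro mult_left_mono)
      have "(\<Sum>k<n. t ^ k / fact k) \<le> (\<Sum>k. t ^ k / fact k)"
        using t summable_exp[of t] by (intro sum_le_suminf) (auto simp: divide_inverse mult.commute)
      then show "(\<Sum>k<n. t ^ k / fact k) \<le> exp t"
        by (simp add: exp_def divide_inverse mult.commute)
    qed (use C t in simp)
    finally show ?thesis by simp
  qed
  moreover have "(\<lambda>n. C * t * exp t + norm x ^ m * (exp t * M0) * (t ^ n / fact n))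
      \<longlonglongrightarrow> C * t * exp t + norm x ^ m * (exp t * M0) * 0"
    using summable_LIMSEQ_zero[OF summable_exp[of t]]
    by (intro tendsto_intros) (simp add: divide_inverse mult.commute)
  ultimately have "norm x ^ m * (exp t * W x t) \<le> C * t * exp t + norm x ^ m * (exp t * M0) * 0"
    by (intro LIMSEQ_le_const[where a="norm x ^ m * (exp t * W x t)"]) auto
  then have "(norm x ^ m * W x t) * exp t \<le> (C * t) * exp t" by (simp add: mult_ac)
  then have "norm x ^ m * W x t \<le> C * t" by simp
  then show ?thesis using x by (simp add: pos_le_divide_eq mult.commute)
qed

theorem theorem2p1:
  fixes J :: "real ^ 'n \<Rightarrow> real"
  assumes "smooth_on J UNIV"
    and "compactly_supported J"
    and "radially_symmetric J"
    and "\<And>x. J x \<ge> 0"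
    and "integral\<^sup>L lborel J = 1"
  shows "\<exists>C>0. \<forall>W. fundamental_smooth_part J W \<longrightarrow>
           (\<forall>x t. x \<noteq> 0 \<longrightarrow> t > 0 \<longrightarrow> W x t \<le> C * (t / norm x ^ (CARD('n) + 2)))"
proof -
  have "Ck_on 0 J UNIV" using assms(1) unfolding smooth_on_def by blast
  then have J: "even_density J" using assms by (intro even_densityI) simp_all
  obtain R where R: "0 \<le> R" "\<And>z. R < norm z \<Longrightarrow> J z = 0"
    using compactly_supported_norm_bound[OF assms(2)] by blast
  obtain C where C: "0 \<le> C"
    "\<And>n x. norm x ^ (CARD('n) + 2) * conv_pow J n x \<le> C * real (Suc n)"
    using conv_pow_moment_bound[OF J R(2,1)] unfolding DIM_cart DIM_real mult_1_right by blast
  \<comment> \<open>Replacing \<open>C\<close> by \<open>C + 1\<close> makes the final constant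
    strictly positive.\<close>
  have C': "norm x ^ (CARD('n) + 2) * conv_pow J n x \<le> (C + 1) * real (Suc n)" for n x
    using C(2)[of x n] by (simp add: distrib_right)
  have "W x t \<le> (C + 1) * (t / norm x ^ (CARD('n) + 2))"
    if "fundamental_smooth_part J W" "x \<noteq> 0" "0 < t" for W x t
    by (rule fundamental_smooth_part_bound[OF J that(1) _ C' that(2,3)]) (use C(1) in simp)
  moreover have "0 < C + 1" using C(1) by simp
  ultimately show ?thesis by blast
qed

end
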